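(* Let $m,n\ge 2$ be integers and let $G=P_m\square P_n$ be the $m\times n$ grid graph, with vertex set $\{(i,j):1\le i\le m,\ 1\le j\le n\}$. For every vertex $(i,j)$ of $G$, each of the following holds: 1. if $1\le i\le\lceil\frac m2\rceil$ and $1\le j\le\lceil\frac n2\rceil$, then $e_G((i,j))=d_G((i,j),(m,n))$ and $(i,j)$ is adjacent to $(m,n)$ in $E(G)$; 2. if $\lfloor\frac m2\rfloor<i\le m$ and $\lfloor\frac n2\rfloor<j\le n$, then $e_G((i,j))=d_G((i,j),(1,1))$ and $(i,j)$ is adjacent to $(1,1)$ in $E(G)$; 3. if $1\le i\le\lceil\frac m2\rceil$ and $\lfloor\frac n2\rfloor<j\le n$, then $e_G((i,j))=d_G((i,j),(m,1))$ and $(i,j)$ is adjacent to $(m,1)$ in $E(G)$; 4. if $\lfloor\frac m2\rfloor<i\le m$ and $1\le j\le\lceil\frac n2\rceil$, then $e_G((i,j))=d_G((i,j),(1,n))$ and $(i,j)$ is adjacent to $(1,n)$ in $E(G)$.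
   Context: $P_n$ is the path graph on vertices $1,2,\dots,n$ with consecutive integers adjacent. In the Cartesian product $P_m\square P_n$, $(i,j)$ is adjacent to $(i',j')$ iff either $i=i'$ and $|j-j'|=1$, or $|i-i'|=1$ and $j=j'$. For a connected simple graph $G$, $d_G$ is the graph distance and $e_G(v)=\max\{d_G(u,v):u\in V(G)\}$. A vertex $u$ is eccentric to $v$ if $d_G(u,v)=e_G(v)$. The eccentric graph $E(G)$ is the simple graph on vertex set $V(G)$ in which two distinct vertices $u,v$ are adjacent iff $u$ is eccentric to $v$ or $v$ is eccentric to $u$. *)

theory Defs
  imports Complex_Main "Graph_Theory.Pair_Digraph" "Graph_Theory.Shortest_Path"
begin

text \<open>
  A finite simple graph is a \<^term>\<open>G :: 'a pair_pre_digraph\<close> with \<^term>\<open>pair_graph G\<close>: an edge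
  between \<open>u\<close> and \<open>v\<close> is the pair of arcs \<open>(u, v)\<close> and \<open>(v, u)\<close>. The library coercion
  \<^const>\<open>with_proj\<close> is inserted wherever a \<^typ>\<open>('a, 'a \<times> 'a) pre_digraph\<close> is expected.
\<close>

definition path_graph :: "nat \<Rightarrow> nat pair_pre_digraph" where
  "path_graph n =
     \<lparr> pverts = {1..n},
       parcs = {(i, j). i \<in> {1..n} \<and> j \<in> {1..n} \<and> \<bar>int i - int j\<bar> = 1} \<rparr>"

definition cartesian_product ::
    "'a pair_pre_digraph \<Rightarrow> 'b pair_pre_digraph \<Rightarrow> ('a \<times> 'b) pair_pre_digraph" where
  "cartesian_product G H =
     \<lparr> pverts = pverts G \<times> pverts H,
       parcs = {((i, j), (i', j')).
         (i, j) \<in> pverts G \<times> pverts H \<and> (i', j') \<in> pverts G \<times> pverts H \<and>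
         (i = i' \<and> (j, j') \<in> parcs H \<or> (i, i') \<in> parcs G \<and> j = j')} \<rparr>"

definition grid_graph :: "nat \<Rightarrow> nat \<Rightarrow> (nat \<times> nat) pair_pre_digraph" where
  "grid_graph m n = cartesian_product (path_graph m) (path_graph n)"

text \<open>
  With unit arc weights the cost of a walk is its length, so the shortest-path cost is the usual
  graph distance (with value \<open>\<infinity>\<close> for vertices in different components).
\<close>

definition graph_dist :: "'a pair_pre_digraph \<Rightarrow> 'a \<Rightarrow> 'a \<Rightarrow> ereal" where
  "graph_dist G u v = wf_digraph.\<mu> G (\<lambda>_. 1) u v"

definition eccentricity :: "'a pair_pre_digraph \<Rightarrow> 'a \<Rightarrow> ereal" where
  "eccentricity G v = Max {graph_dist G u v | u. u \<in> pverts G}"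

definition eccentric_to :: "'a pair_pre_digraph \<Rightarrow> 'a \<Rightarrow> 'a \<Rightarrow> bool" where
  "eccentric_to G u v \<longleftrightarrow> u \<in> pverts G \<and> graph_dist G u v = eccentricity G v"

definition eccentric_graph :: "'a pair_pre_digraph \<Rightarrow> 'a pair_pre_digraph" where
  "eccentric_graph G =
     \<lparr> pverts = pverts G,
       parcs = {(u, v). u \<in> pverts G \<and> v \<in> pverts G \<and> u \<noteq> v \<and>
         (eccentric_to G u v \<or> eccentric_to G v u)} \<rparr>"

lemma pair_graph_path_graph: "pair_graph (path_graph n)"
proof
  show "finite (parcs (path_graph n))"
    by (rule finite_subset[of _ "{1..n} \<times> {1..n}"]) (auto simp: path_graph_def)
qed (auto simp: path_graph_def symmetric_def sym_def)

lemma pair_graph_cartesian_product: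
  assumes "pair_graph G" "pair_graph H"
  shows "pair_graph (cartesian_product G H)"
proof -
  interpret G: pair_graph G by fact
  interpret H: pair_graph H by fact
  have sym: "sym (parcs G)" "sym (parcs H)"
    using G.pair_sym_arcs H.pair_sym_arcs by (simp_all add: symmetric_def)
  let ?V = "pverts G \<times> pverts H"
  show ?thesis
  proof
    show "finite (parcs (cartesian_product G H))"
      by (rule finite_subset[of _ "?V \<times> ?V"])
         (auto simp: cartesian_product_def G.pair_finite_verts H.pair_finite_verts)
    show "symmetric (cartesian_product G H)"
      using sym by (auto simp: cartesian_product_def symmetric_def sym_def)
  qed (auto simp: cartesian_product_def G.pair_finite_verts H.pair_finite_verts
        dest: G.pair_no_loops H.pair_no_loops)
qed

lemma pair_graph_grid_graph: "pair_graph (grid_graph m n)"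
  by (simp add: grid_graph_def pair_graph_cartesian_product pair_graph_path_graph)

lemma pair_graph_eccentric_graph:
  assumes "pair_graph G"
  shows "pair_graph (eccentric_graph G)"
proof -
  interpret G: pair_graph G by fact
  show ?thesis
  proof
    show "finite (parcs (eccentric_graph G))"
      by (rule finite_subset[of _ "pverts G \<times> pverts G"])
         (auto simp: eccentric_graph_def G.pair_finite_verts)
  qed (auto simp: eccentric_graph_def G.pair_finite_verts symmetric_def sym_def)
qed

end

(*
  The distance in the grid is the taxicab distance, which splits into a row and a column part.
  In each coordinate the end of the path lying on the far side of the midpoint is the farthest
  point, so the corner combining the two far ends is eccentric.
*)
theory Submission
  imports Defs
begin

text \<open>Such a potential \<open>f\<close> bounds the length of every walk to \<open>v\<close> from below, and descending
  along it produces a walk of length \<open>f u\<close>.\<close>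

lemma graph_dist_eqI:
  fixes f :: "'a \<Rightarrow> nat"
  assumes G: "pair_graph G" and u: "u \<in> pverts G" and v: "v \<in> pverts G"
    and zero: "f v = 0"
    and arc: "\<And>x y. (x, y) \<in> parcs G \<Longrightarrow> f x \<le> Suc (f y)"
    and descent: "\<And>x. x \<in> pverts G \<Longrightarrow> x \<noteq> v \<Longrightarrow> \<exists>y. (x, y) \<in> parcs G \<and> f x = Suc (f y)"
  shows "graph_dist G u v = ereal (real (f u))"
proof -
  interpret pair_graph G by fact
  have lower: "real (f x) \<le> awalk_cost (\<lambda>_. 1) p" if "awalk x p v" for x p
    using that
  proof (induction p arbitrary: x)
    case Nil
    then show ?case using zero by (simp add: awalk_Nil_iff)
  next
    case (Cons e p)
    then have "(x, snd e) \<in> parcs G" "awalk (snd e) p v"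
      by (auto simp: awalk_Cons_iff)
    then show ?case
      using Cons.IH[of "snd e"] arc[of x "snd e"] by simp
  qed
  have upper: "\<exists>p. awalk x p v \<and> awalk_cost (\<lambda>_. 1) p = real (f x)" if "x \<in> pverts G" for x
    using that
  proof (induction "f x" arbitrary: x)
    case 0
    \<comment> \<open>By \<open>descent\<close> the value of \<open>f\<close> at any vertex other
      than \<open>v\<close> is a successor, so \<open>v\<close> is the only zero.\<close>
    then have "x = v" using descent[of x] by force
    then show ?case
      using v zero by (intro exI[of _ "[]"]) (simp add: awalk_Nil_iff)
  next
    case (Suc k)
    then have "x \<noteq> v" using zero by auto
    then obtain y where y: "(x, y) \<in> parcs G" "f x = Suc (f y)"
      using descent Suc.prems by blast
    then have "y \<in> pverts G" by (auto dest: in_arcsD2)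
    then obtain p where "awalk y p v" "awalk_cost (\<lambda>_. 1) p = real (f y)"
      using Suc.hyps y by auto
    then show ?case
      using y by (intro exI[of _ "(x, y) # p"]) (simp add: awalk_Cons_iff)
  qed
  obtain p where p: "awalk u p v" "awalk_cost (\<lambda>_. 1) p = real (f u)"
    using upper u by blast
  show ?thesis
    unfolding graph_dist_def
  proof (rule antisym)
    show "\<mu> (\<lambda>_. 1) u v \<le> ereal (real (f u))"
      using min_cost_le_walk_cost[OF p(1), of "\<lambda>_. 1"] p(2) by simp
    show "ereal (real (f u)) \<le> \<mu> (\<lambda>_. 1) u v"
      unfolding \<mu>_def using lower by (auto intro!: INF_greatest)
  qed
qed

lemma pverts_grid_graph: "pverts (grid_graph m n) = {1..m} \<times> {1..n}"
  by (simp add: grid_graph_def cartesian_product_def path_graph_def)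

lemma parcs_grid_graph:
  "((a, b), (c, d)) \<in> parcs (grid_graph m n) \<longleftrightarrow>
     a \<in> {1..m} \<and> b \<in> {1..n} \<and> c \<in> {1..m} \<and> d \<in> {1..n} \<and>
     (a = c \<and> \<bar>int b - int d\<bar> = 1 \<or> \<bar>int a - int c\<bar> = 1 \<and> b = d)"
  by (auto simp: grid_graph_def cartesian_product_def path_graph_def)

text \<open>Taxicab distance to \<open>(c, d)\<close> serves as the potential: an arc changes one
  coordinate by one, hence the value by at most one, and away from the target some coordinate can be
  moved one step closer.\<close>

lemma graph_dist_grid_graph:
  assumes "(a, b) \<in> pverts (grid_graph m n)" and "(c, d) \<in> pverts (grid_graph m n)"
  shows "graph_dist (grid_graph m n) (a, b) (c, d)
    = ereal (real (nat (\<bar>int a - int c\<bar> + \<bar>int b - int d\<bar>)))"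
proof -
  define f where "f x = nat (\<bar>int (fst x) - int c\<bar> + \<bar>int (snd x) - int d\<bar>)" for x
  have "graph_dist (grid_graph m n) (a, b) (c, d) = ereal (real (f (a, b)))"
  proof (rule graph_dist_eqI[OF pair_graph_grid_graph assms])
    show "f (c, d) = 0" by (simp add: f_def)
  next
    fix x y assume "(x, y) \<in> parcs (grid_graph m n)"
    then show "f x \<le> Suc (f y)"
      by (cases x; cases y) (auto simp: f_def parcs_grid_graph)
  next
    fix x assume x: "x \<in> pverts (grid_graph m n)" "x \<noteq> (c, d)"
    obtain p q where pq: "x = (p, q)" by fastforce
    have bounds: "p \<in> {1..m}" "q \<in> {1..n}" "c \<in> {1..m}" "d \<in> {1..n}"
      using x(1) assms(2) by (auto simp: pq pverts_grid_graph)
    \<comment> \<open>Correct the row first, then the column; each step heads for the target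
      coordinate, so it stays inside the grid.\<close>
    consider "p < c" | "c < p" | "p = c" "q < d" | "p = c" "d < q"
      using x(2) unfolding pq by (metis linorder_neqE_nat)
    then show "\<exists>y. (x, y) \<in> parcs (grid_graph m n) \<and> f x = Suc (f y)"
    proof cases
      case 1
      then show ?thesis using bounds
        by (intro exI[of _ "(p + 1, q)"]) (auto simp: pq f_def parcs_grid_graph)
    next
      case 2
      then show ?thesis using bounds
        by (intro exI[of _ "(p - 1, q)"]) (auto simp: pq f_def parcs_grid_graph)
    next
      case 3
      then show ?thesis using bounds
        by (intro exI[of _ "(p, q + 1)"]) (auto simp: pq f_def parcs_grid_graph)
    next
      case 4
      then show ?thesis using bounds
        by (intro exI[of _ "(p, q - 1)"]) (auto simp: pq f_def parcs_grid_graph)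
    qed
  qed
  then show ?thesis by (simp add: f_def)
qed

text \<open>Taxicab distance is a sum over the coordinates, so a vertex that is farthest in each
  coordinate separately is farthest overall. The assumption \<open>ne\<close> is there because the
  eccentric graph has no loops.\<close>

lemma eccentric_grid_graphI:
  assumes ij: "(i, j) \<in> pverts (grid_graph m n)" and ab: "(a, b) \<in> pverts (grid_graph m n)"
    and ne: "(i, j) \<noteq> (a, b)"
    and row: "\<And>k. k \<in> {1..m} \<Longrightarrow> \<bar>int k - int i\<bar> \<le> \<bar>int a - int i\<bar>"
    and col: "\<And>l. l \<in> {1..n} \<Longrightarrow> \<bar>int l - int j\<bar> \<le> \<bar>int b - int j\<bar>"
  shows "eccentricity (grid_graph m n) (i, j) = graph_dist (grid_graph m n) (i, j) (a, b) \<and>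
    ((i, j), (a, b)) \<in> parcs (eccentric_graph (grid_graph m n))"
proof -
  let ?G = "grid_graph m n"
  have dist_le: "graph_dist ?G u (i, j) \<le> graph_dist ?G (a, b) (i, j)" if "u \<in> pverts ?G" for u
  proof -
    obtain k l where u: "u = (k, l)" by fastforce
    then have "k \<in> {1..m}" "l \<in> {1..n}"
      using that by (auto simp: pverts_grid_graph)
    from row[OF this(1)] col[OF this(2)] show ?thesis
      using that ij ab by (simp add: u graph_dist_grid_graph)
  qed
  have "finite {graph_dist ?G u (i, j) | u. u \<in> pverts ?G}"
    unfolding Setcompr_eq_image by (simp add: pverts_grid_graph)
  then have ecc: "eccentricity ?G (i, j) = graph_dist ?G (a, b) (i, j)"
    unfolding eccentricity_def using dist_le ab by (intro Max_eqI) auto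
  \<comment> \<open>\<open>eccentricity\<close> measures distances towards its argument, while the
    conclusion measures them from \<open>(i, j)\<close>.\<close>
  moreover have "graph_dist ?G (a, b) (i, j) = graph_dist ?G (i, j) (a, b)"
    using ij ab by (simp add: graph_dist_grid_graph abs_minus_commute)
  ultimately show ?thesis
    using ij ab ne by (simp add: eccentric_graph_def eccentric_to_def)
qed

text \<open>Without rounding, the condition is \<open>k - 1 \<le> m - k\<close> over the integers:
  the end \<open>m\<close> is at least as far from \<open>k\<close> as the end 1.\<close>

lemma int_le_ceiling_half_iff: "int k \<le> \<lceil>real m / 2\<rceil> \<longleftrightarrow> 2 * k \<le> m + 1"
  by linarith

text \<open>The mirror condition \<open>m - k \<le> k - 1\<close>: the end 1 is at least as far. For
  odd \<open>m\<close> the midpoint satisfies both conditions.\<close>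

lemma floor_half_less_int_iff: "\<lfloor>real m / 2\<rfloor> < int k \<longleftrightarrow> m < 2 * k"
  by linarith

theorem mainTheorem10:
  fixes m n i j :: nat
  assumes "m \<ge> 2" and "n \<ge> 2"
    and "(i, j) \<in> pverts (grid_graph m n)"
  shows
    "(1 \<le> i \<and> int i \<le> \<lceil>real m / 2\<rceil> \<and> 1 \<le> j \<and> int j \<le> \<lceil>real n / 2\<rceil> \<longrightarrow>
        eccentricity (grid_graph m n) (i, j) = graph_dist (grid_graph m n) (i, j) (m, n) \<and>
        ((i, j), (m, n)) \<in> parcs (eccentric_graph (grid_graph m n))) \<and>
     (\<lfloor>real m / 2\<rfloor> < int i \<and> i \<le> m \<and> \<lfloor>real n / 2\<rfloor> < int j \<and> j \<le> n \<longrightarrow>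
        eccentricity (grid_graph m n) (i, j) = graph_dist (grid_graph m n) (i, j) (1, 1) \<and>
        ((i, j), (1, 1)) \<in> parcs (eccentric_graph (grid_graph m n))) \<and>
     (1 \<le> i \<and> int i \<le> \<lceil>real m / 2\<rceil> \<and> \<lfloor>real n / 2\<rfloor> < int j \<and> j \<le> n \<longrightarrow>
        eccentricity (grid_graph m n) (i, j) = graph_dist (grid_graph m n) (i, j) (m, 1) \<and>
        ((i, j), (m, 1)) \<in> parcs (eccentric_graph (grid_graph m n))) \<and>
     (\<lfloor>real m / 2\<rfloor> < int i \<and> i \<le> m \<and> 1 \<le> j \<and> int j \<le> \<lceil>real n / 2\<rceil> \<longrightarrow>
        eccentricity (grid_graph m n) (i, j) = graph_dist (grid_graph m n) (i, j) (1, n) \<and>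
        ((i, j), (1, n)) \<in> parcs (eccentric_graph (grid_graph m n)))"
proof -
  have ij: "1 \<le> i" "i \<le> m" "1 \<le> j" "j \<le> n"
    using assms(3) by (auto simp: pverts_grid_graph)
  show ?thesis
    unfolding int_le_ceiling_half_iff floor_half_less_int_iff
    using assms ij
    \<comment> \<open>Restricting \<open>conjI\<close> to implications splits off the four cases but
      keeps each two-part conclusion whole for \<open>eccentric_grid_graphI\<close>. The corner
      differs from \<open>(i, j)\<close>: for instance, \<open>i = m\<close> and
      \<open>2 * i \<le> m + 1\<close> would force \<open>m \<le> 1\<close>.\<close>
    by (intro conjI[of "_ \<longrightarrow> _"] impI eccentric_grid_graphI) (auto simp: pverts_grid_graph)
qed

end
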